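(* Let $\kappa$ be an infinite cardinal with $\kappa = \kappa^{<\kappa}$. For every point $x$ of $S_\kappa$, the space $S_\kappa \setminus \{x\}$ has arbitrarily large finite compactifications; that is, for every $n \in \mathbb{N}$ there is a finite compactification of $S_\kappa \setminus \{x\}$ whose remainder has at least $n$ points.
   Context: A space is zero-dimensional if it has a basis of clopen sets. In a zero-dimensional space $X$, the type of an open subset $U$ is the least cardinal $\tau$ such that $U$ is a union of $\tau$-many clopen subsets of $X$. An $F_\kappa$-space is a zero-dimensional space in which every open subset of type less than $\kappa$ is $C^*$-embedded (every bounded continuous real-valued function on it extends continuously to the whole space). A $\kappa$-Parovičenko space is a zero-dimensional compact Hausdorff $F_\kappa$-space of weight $\kappa^{<\kappa}$ without isolated points such that every non-empty intersection of fewer than $\kappa$-many open sets has non-empty interior. If $\kappa = \kappa^{<\kappa}$, there is, up to homeomorphism, a unique $\kappa$-Parovičenko space of weight $\kappa$; it is denoted $S_\kappa$ (equivalently, the Stone space of the unique $\kappa$-saturated Boolean algebra of size $\kappa$). A finite compactification of a space $Y$ is a compact Hausdorff space $Z$ containing $Y$ as a dense subspace such that the remainder $Z\setminus Y$ is finite. *)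

theory Defs
  imports "HOL-Analysis.Analysis"
begin

unbundle cardinal_syntax

(* \<kappa> is a cardinal as in the HOL cardinal library: a relation satisfying Card_order. The partial
   functions below are the elements of the set of all functions \<alpha> \<rightarrow> \<kappa> with \<alpha> < \<kappa>; an ordinal
   \<alpha> < \<kappa> is the proper initial segment underS \<kappa> a, and \<rightharpoonup> keeps track of the domain. *)
definition card_less_power :: "'k rel \<Rightarrow> ('k \<rightharpoonup> 'k) rel" where
  "card_less_power \<kappa> = |{f. \<exists>a\<in>Field \<kappa>. dom f = underS \<kappa> a \<and> ran f \<subseteq> Field \<kappa>}|"

definition least_card :: "'b set set \<Rightarrow> 'b rel" where
  "least_card \<A> = |SOME A. A \<in> \<A> \<and> (\<forall>B\<in>\<A>. |A| \<le>o |B| )|"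

lemma least_card_attained:
  assumes "\<A> \<noteq> {}"
  shows "\<exists>A\<in>\<A>. least_card \<A> = |A| \<and> (\<forall>B\<in>\<A>. |A| \<le>o |B| )"
proof -
  have "\<exists>r \<in> card_of ` \<A>. \<forall>r' \<in> card_of ` \<A>. r \<le>o r'"
    using assms by (intro exists_minim_Card_order) (auto simp: card_of_Card_order)
  then have "\<exists>A. A \<in> \<A> \<and> (\<forall>B\<in>\<A>. |A| \<le>o |B| )"
    by auto
  from someI_ex[OF this] show ?thesis
    unfolding least_card_def by auto
qed

definition base_of :: "'a topology \<Rightarrow> 'a set set \<Rightarrow> bool" where
  "base_of X \<B> \<longleftrightarrow> (\<forall>V\<in>\<B>. openin X V) \<and>
     (\<forall>U x. openin X U \<and> x \<in> U \<longrightarrow> (\<exists>V\<in>\<B>. x \<in> V \<and> V \<subseteq> U))"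

definition weight :: "'a topology \<Rightarrow> 'a set rel" where
  "weight X = least_card {\<B>. base_of X \<B>}"

definition clopenin :: "'a topology \<Rightarrow> 'a set \<Rightarrow> bool" where
  "clopenin X U \<longleftrightarrow> openin X U \<and> closedin X U"

definition zero_dimensional_space :: "'a topology \<Rightarrow> bool" where
  "zero_dimensional_space X \<longleftrightarrow> (\<exists>\<B>. base_of X \<B> \<and> (\<forall>V\<in>\<B>. clopenin X V))"

(* Only meaningful for U open in a zero-dimensional X: otherwise the collection below may be empty. *)
definition open_type :: "'a topology \<Rightarrow> 'a set \<Rightarrow> 'a set rel" where
  "open_type X U = least_card {\<C>. (\<forall>V\<in>\<C>. clopenin X V) \<and> \<Union>\<C> = U}"

definition Cstar_embedded :: "'a topology \<Rightarrow> 'a set \<Rightarrow> bool" where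
  "Cstar_embedded X U \<longleftrightarrow>
     (\<forall>f::'a \<Rightarrow> real. continuous_map (subtopology X U) euclideanreal f \<and> bounded (f ` U) \<longrightarrow>
        (\<exists>g. continuous_map X euclideanreal g \<and> (\<forall>x\<in>U. g x = f x)))"

definition F_space :: "'k rel \<Rightarrow> 'a topology \<Rightarrow> bool" where
  "F_space \<kappa> X \<longleftrightarrow> zero_dimensional_space X \<and>
     (\<forall>U. openin X U \<and> open_type X U <o \<kappa> \<longrightarrow> Cstar_embedded X U)"

(* Intersecting with topspace X makes the empty family of open sets have intersection X. *)
definition Parovicenko_space :: "'k rel \<Rightarrow> 'a topology \<Rightarrow> bool" where
  "Parovicenko_space \<kappa> X \<longleftrightarrow>
     zero_dimensional_space X \<and> compact_space X \<and> Hausdorff_space X \<and> F_space \<kappa> X \<and>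
     weight X =o card_less_power \<kappa> \<and>
     (\<forall>x\<in>topspace X. \<not> openin X {x}) \<and>
     (\<forall>\<U>. (\<forall>U\<in>\<U>. openin X U) \<and> |\<U>| <o \<kappa> \<and> topspace X \<inter> \<Inter>\<U> \<noteq> {} \<longrightarrow>
        X interior_of (topspace X \<inter> \<Inter>\<U>) \<noteq> {})"

(* S_\<kappa>, determined up to homeomorphism when \<kappa> is infinite and \<kappa> = \<kappa>^{<\<kappa>}. *)
definition is_S :: "'k rel \<Rightarrow> 'a topology \<Rightarrow> bool" where
  "is_S \<kappa> X \<longleftrightarrow> Parovicenko_space \<kappa> X \<and> weight X =o \<kappa>"

definition finite_compactification :: "'a topology \<Rightarrow> 'b topology \<Rightarrow> ('a \<Rightarrow> 'b) \<Rightarrow> bool" where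
  "finite_compactification Y Z e \<longleftrightarrow>
     compact_space Z \<and> Hausdorff_space Z \<and> embedding_map Y Z e \<and>
     Z closure_of (e ` topspace Y) = topspace Z \<and> finite (topspace Z - e ` topspace Y)"

end

(* The idea: it suffices to partition X - {x} into n open sets A i that all accumulate at x, since then
   x can be replaced by n points, one for each A i. Let (W a), a < \<kappa>, be a clopen neighbourhood base of x.
   The A i are built as increasing unions of clopen sets E a i, by recursion on a < \<kappa>. At stage a, the
   union of what has been put into the n pieces so far is an open set of type less than \<kappa> that misses x.
   As it is C*-embedded, a clopen partition (Q i) of X extends the partial partition, and it is
   used to distribute all of X - W a. As the complement of this union meets W a, in x, its intersection
   with W a has non-empty interior and so provides new points of W a for every piece. *)
theory Submission
  imports Defs
begin

section \<open>Clopen sets in zero-dimensional spaces\<close>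

lemma least_card_le: "A \<in> \<A> \<Longrightarrow> least_card \<A> \<le>o |A|"
  by (metis empty_iff least_card_attained)

lemma clopenin_Un: "clopenin X S \<Longrightarrow> clopenin X T \<Longrightarrow> clopenin X (S \<union> T)"
  and clopenin_Diff: "clopenin X S \<Longrightarrow> clopenin X T \<Longrightarrow> clopenin X (S - T)"
  and clopenin_topspace: "clopenin X (topspace X)"
  by (auto simp: clopenin_def openin_diff closedin_diff)

lemma clopenin_Union: "finite \<C> \<Longrightarrow> (\<And>S. S \<in> \<C> \<Longrightarrow> clopenin X S) \<Longrightarrow> clopenin X (\<Union>\<C>)"
  by (auto simp: clopenin_def closedin_Union)

lemma zero_dimensional_space_nbhd:
  assumes "zero_dimensional_space X" "openin X U" "x \<in> U"
  obtains V where "clopenin X V" "x \<in> V" "V \<subseteq> U"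
  using assms unfolding zero_dimensional_space_def base_of_def by metis

lemma zero_dimensional_space_compactin_nbhd:
  assumes "zero_dimensional_space X" "compactin X K" "openin X U" "K \<subseteq> U"
  shows "\<exists>P. clopenin X P \<and> K \<subseteq> P \<and> P \<subseteq> U"
proof -
  let ?\<C> = "{V. clopenin X V \<and> V \<subseteq> U}"
  have "K \<subseteq> \<Union>?\<C>"
  proof
    fix y assume "y \<in> K"
    then have "y \<in> U"
      using assms(4) by auto
    then show "y \<in> \<Union>?\<C>"
      using zero_dimensional_space_nbhd[OF assms(1,3)] by blast
  qed
  moreover have "\<And>V. V \<in> ?\<C> \<Longrightarrow> openin X V"
    by (auto simp: clopenin_def)
  ultimately obtain \<F> where "finite \<F>" "\<F> \<subseteq> ?\<C>" "K \<subseteq> \<Union>\<F>"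
    using compactinD[OF assms(2), of ?\<C>] by metis
  then show ?thesis
    by (intro exI[of _ "\<Union>\<F>"]) (auto intro!: clopenin_Union)
qed

text \<open>Without isolated points, \<open>N\<close> has two points \<open>p\<close> and
  \<open>q\<close>. A clopen neighbourhood of \<open>p\<close> inside \<open>N\<close> that avoids
  \<open>q\<close> serves as one set, and what remains of \<open>N\<close> is open and still
  contains \<open>q\<close>, so the induction continues there.\<close>

lemma open_contains_disjoint_clopens:
  assumes "zero_dimensional_space X" "Hausdorff_space X" "\<And>y. y \<in> topspace X \<Longrightarrow> \<not> openin X {y}"
    and "openin X N" "N \<noteq> {}"
  shows "\<exists>D::nat \<Rightarrow> 'a set. (\<forall>i<n. clopenin X (D i) \<and> D i \<noteq> {} \<and> D i \<subseteq> N) \<and>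
           (\<forall>i<n. \<forall>j<n. i \<noteq> j \<longrightarrow> D i \<inter> D j = {})"
  using assms(4,5)
proof (induction n arbitrary: N)
  case 0
  then show ?case by simp
next
  case (Suc n)
  obtain p where p: "p \<in> N" "p \<in> topspace X"
    using Suc.prems openin_subset by blast
  then have "N \<noteq> {p}"
    using assms(3)[of p] Suc.prems(1) by auto
  then obtain q where q: "q \<in> N" "q \<noteq> p"
    using p by auto
  have "openin X (N - {q})"
    using Suc.prems(1) assms(2)
    by (metis Hausdorff_imp_t1_space openin_diff closedin_t1_singleton openin_subset q(1) subsetD)
  then obtain V where V: "clopenin X V" "p \<in> V" "V \<subseteq> N - {q}"
    using zero_dimensional_space_nbhd[OF assms(1)] p q by (metis Diff_iff singletonD)
  have "openin X (N - V)" "N - V \<noteq> {}"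
    using V q Suc.prems by (auto simp: clopenin_def openin_diff)
  from Suc.IH[OF this] obtain D :: "nat \<Rightarrow> 'a set"
    where D: "\<forall>i<n. clopenin X (D i) \<and> D i \<noteq> {} \<and> D i \<subseteq> N - V"
      "\<forall>i<n. \<forall>j<n. i \<noteq> j \<longrightarrow> D i \<inter> D j = {}"
    by metis
  have disj: "\<forall>i<n. D i \<inter> V = {}" "\<forall>i<n. V \<inter> D i = {}"
    using D(1) by blast+
  have "\<forall>i<Suc n. clopenin X ((D(n := V)) i) \<and> (D(n := V)) i \<noteq> {} \<and> (D(n := V)) i \<subseteq> N"
    using D(1) V by (auto simp: less_Suc_eq)
  moreover have "\<forall>i<Suc n. \<forall>j<Suc n. i \<noteq> j \<longrightarrow> (D(n := V)) i \<inter> (D(n := V)) j = {}"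
    using D(2) disj by (simp add: less_Suc_eq)
  ultimately show ?case by blast
qed

section \<open>Clopen partitions from C*-embedding\<close>

lemma the_index_disjoint_family:
  fixes A :: "nat \<Rightarrow> 'a set"
  assumes "\<And>i j. i < n \<Longrightarrow> j < n \<Longrightarrow> i \<noteq> j \<Longrightarrow> A i \<inter> A j = {}"
    and "i < n" "y \<in> A i"
  shows "(THE i. i < n \<and> y \<in> A i) = i"
proof (rule the_equality)
  fix j assume "j < n \<and> y \<in> A j"
  then show "j = i"
    using assms(1)[of i j] assms(2,3) by blast
qed (simp add: assms)

text \<open>The function with value i on \<open>A i\<close> is locally constant and bounded on the
  union, so it extends to a continuous g on X. The level sets of g at different integers can be
  separated by clopen sets.\<close>

lemma Cstar_embedded_clopen_partition:
  fixes A :: "nat \<Rightarrow> 'a set"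
  assumes zd: "zero_dimensional_space X" and comp: "compact_space X" and n: "0 < n"
    and op: "\<And>i. i < n \<Longrightarrow> openin X (A i)"
    and disj: "\<And>i j. i < n \<Longrightarrow> j < n \<Longrightarrow> i \<noteq> j \<Longrightarrow> A i \<inter> A j = {}"
    and emb: "Cstar_embedded X (\<Union>i<n. A i)"
  shows "\<exists>Q. (\<forall>i<n. clopenin X (Q i) \<and> A i \<subseteq> Q i) \<and> (\<Union>i<n. Q i) = topspace X \<and>
             (\<forall>i<n. \<forall>j<n. i \<noteq> j \<longrightarrow> Q i \<inter> Q j = {})"
proof -
  let ?U = "\<Union>i<n. A i"
  \<comment> \<open>Off the union the value is unspecified; only the restriction of \<open>f\<close>
    to the union is ever used.\<close>
  define f where "f y = real (THE i. i < n \<and> y \<in> A i)" for y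
  have f: "f y = real i" if "i < n" "y \<in> A i" for y i
    unfolding f_def using the_index_disjoint_family[of n A, OF disj that] by simp
  have "continuous_map (subtopology X ?U) euclideanreal f"
  unfolding continuous_map_def
  proof (intro conjI allI impI)
    fix T :: "real set" assume "openin euclideanreal T"
    have UX: "?U \<subseteq> topspace X"
      using op openin_subset by blast
    have "{y \<in> topspace (subtopology X ?U). f y \<in> T} = (\<Union>i\<in>{i. i < n \<and> real i \<in> T}. A i)"
      (is "?L = ?R")
    proof
      show "?L \<subseteq> ?R"
      proof
        fix y assume "y \<in> ?L"
        then obtain i where "i < n" "y \<in> A i" "f y \<in> T" by auto
        then show "y \<in> ?R" using f[of i y] by auto
      qed
      show "?R \<subseteq> ?L"
      proof
        fix y assume "y \<in> ?R"
        then obtain i where "i < n" "y \<in> A i" "real i \<in> T" by auto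
        then show "y \<in> ?L" using f[of i y] UX by auto
      qed
    qed
    moreover have "openin X ?R"
      using op by auto
    ultimately show "openin (subtopology X ?U) ?L"
      using op by (subst openin_open_subtopology) auto
  qed auto
  moreover have "bounded (f ` ?U)"
  proof -
    have "f ` ?U \<subseteq> real ` {..<n}"
    proof
      fix z assume "z \<in> f ` ?U"
      then obtain y i where "z = f y" "i < n" "y \<in> A i" by auto
      then show "z \<in> real ` {..<n}" using f[of i y] by auto
    qed
    then show ?thesis
      by (meson finite_imageI finite_lessThan finite_imp_bounded bounded_subset)
  qed
  ultimately have "\<exists>g. continuous_map X euclideanreal g \<and> (\<forall>y\<in>?U. g y = f y)"
    using emb[unfolded Cstar_embedded_def, rule_format, of f] by simp
  then obtain g where g: "continuous_map X euclideanreal g" "\<And>y. y \<in> ?U \<Longrightarrow> g y = f y"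
    by blast
  \<comment> \<open>Level sets of \<open>g\<close> are closed in a compact space, so a clopen set
    fits between each of them and its open neighbourhood. Radius 1/2 makes the neighbourhoods of
    different integers disjoint.\<close>
  have "\<forall>i. \<exists>P. clopenin X P \<and> {y \<in> topspace X. g y \<in> {real i}} \<subseteq> P \<and>
            P \<subseteq> {y \<in> topspace X. g y \<in> {real i - 1/2 <..< real i + 1/2}}"
  proof (intro allI zero_dimensional_space_compactin_nbhd[OF zd])
    fix i :: nat
    show "compactin X {y \<in> topspace X. g y \<in> {real i}}"
      by (intro closedin_compact_space[OF comp] closedin_continuous_map_preimage[OF g(1)]) auto
    show "openin X {y \<in> topspace X. g y \<in> {real i - 1/2 <..< real i + 1/2}}"
      by (intro openin_continuous_map_preimage[OF g(1)]) auto
  qed auto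
  from choice[OF this] obtain P where "\<forall>i. clopenin X (P i) \<and> {y \<in> topspace X. g y \<in> {real i}} \<subseteq> P i \<and>
            P i \<subseteq> {y \<in> topspace X. g y \<in> {real i - 1/2 <..< real i + 1/2}}" ..
  then have P: "clopenin X (P i)" "{y \<in> topspace X. g y \<in> {real i}} \<subseteq> P i"
    "P i \<subseteq> {y \<in> topspace X. g y \<in> {real i - 1/2 <..< real i + 1/2}}" for i
    by (fast)+
  have Pdisj: "i = j" if "y \<in> P i" "y \<in> P j" for i j y
  proof -
    have "\<bar>real i - real j\<bar> < 1"
      using subsetD[OF P(3) that(1)] subsetD[OF P(3) that(2)] unfolding mem_Collect_eq greaterThanLessThan_iff
      by linarith
    then show ?thesis
      by linarith
  qed
  have AP: "A i \<subseteq> P i" if "i < n" for i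
  proof
    fix y assume "y \<in> A i"
    then show "y \<in> P i"
      using P(2)[of i] g(2)[of y] f[OF that] that openin_subset[OF op[OF that]] by auto
  qed
  \<comment> \<open>Piece 0 absorbs every point that lies in no \<open>P j\<close> with 1 \<le> j <
    n, so that the pieces cover X. It still contains \<open>A 0\<close>, since \<open>P 0\<close> is
    disjoint from the other \<open>P j\<close>.\<close>
  define Q where "Q i = (if i = 0 then topspace X - (\<Union>j\<in>{1..<n}. P j) else P i)" for i
  have PX: "P i \<subseteq> topspace X" for i
    using P(3)[of i] by auto
  have "clopenin X (Q i)" for i
    unfolding Q_def using P(1) by (auto intro!: clopenin_Diff clopenin_topspace clopenin_Union)
  moreover have "A i \<subseteq> Q i" if "i < n" for i
  proof
    fix y assume "y \<in> A i"
    then have "y \<in> topspace X" "y \<in> P i"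
      using AP op[OF that, THEN openin_subset] that by auto
    moreover have "y \<notin> P j" if "i = 0" "j \<in> {1..<n}" for j
      using Pdisj[of y i j] \<open>y \<in> P i\<close> that by auto
    ultimately show "y \<in> Q i"
      by (simp add: Q_def)
  qed
  moreover have "(\<Union>i<n. Q i) = topspace X"
  proof
    show "topspace X \<subseteq> (\<Union>i<n. Q i)"
    proof
      fix y assume y: "y \<in> topspace X"
      show "y \<in> (\<Union>i<n. Q i)"
      proof (cases "\<exists>j\<in>{1..<n}. y \<in> P j")
        case True
        then obtain j where "1 \<le> j" "j < n" "y \<in> P j" by auto
        then have "y \<in> Q j" by (simp add: Q_def)
        then show ?thesis using \<open>j < n\<close> by blast
      next
        case False
        then have "y \<in> Q 0" using y by (simp add: Q_def)
        then show ?thesis using n by blast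
      qed
    qed
  qed (use PX in \<open>auto simp: Q_def split: if_splits\<close>)
  moreover have "Q i \<inter> Q j = {}" if "i < n" "j < n" "i \<noteq> j" for i j
  proof -
    have "P i \<inter> P j = {}"
      using Pdisj that(3) by blast
    then show ?thesis
      using that by (auto simp: Q_def)
  qed
  ultimately show ?thesis
    by blast
qed

section \<open>One stage of the recursion\<close>

text \<open>\<open>J\<close> indexes the earlier stages and \<open>E b i\<close> is what stage b
  contributed to piece i. The new contribution \<open>F i\<close> need not contain the old ones,
  since the pieces are unions over all stages; it only has to avoid what went into other
  pieces.\<close>

lemma Parovicenko_space_extend_partition:
  fixes \<kappa> :: "'k rel" and E :: "'b \<Rightarrow> nat \<Rightarrow> 'a set"
  assumes inf: "Cinfinite \<kappa>" and X: "Parovicenko_space \<kappa> X" and n: "0 < n" and J: "|J| <o \<kappa>"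
    and E: "\<And>b i. b \<in> J \<Longrightarrow> i < n \<Longrightarrow> clopenin X (E b i) \<and> x \<notin> E b i"
    and disj: "\<And>b c i j. b \<in> J \<Longrightarrow> c \<in> J \<Longrightarrow> i < n \<Longrightarrow> j < n \<Longrightarrow> i \<noteq> j \<Longrightarrow> E b i \<inter> E c j = {}"
    and W: "clopenin X W" "x \<in> W"
  shows "\<exists>F. (\<forall>i<n. clopenin X (F i) \<and> x \<notin> F i \<and> F i \<inter> W \<noteq> {}) \<and>
             topspace X - W \<subseteq> (\<Union>i<n. F i) \<and>
             (\<forall>i<n. \<forall>j<n. i \<noteq> j \<longrightarrow> F i \<inter> F j = {}) \<and>
             (\<forall>b\<in>J. \<forall>i<n. \<forall>j<n. i \<noteq> j \<longrightarrow> F i \<inter> E b j = {})"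
proof -
  have zd: "zero_dimensional_space X" and comp: "compact_space X" and haus: "Hausdorff_space X"
    and F: "F_space \<kappa> X" and iso: "\<And>y. y \<in> topspace X \<Longrightarrow> \<not> openin X {y}"
    and int: "\<And>\<U>. (\<forall>U\<in>\<U>. openin X U) \<Longrightarrow> |\<U>| <o \<kappa> \<Longrightarrow> topspace X \<inter> \<Inter>\<U> \<noteq> {} \<Longrightarrow>
        X interior_of (topspace X \<inter> \<Inter>\<U>) \<noteq> {}"
    using X unfolding Parovicenko_space_def by auto
  define G where "G b = (\<Union>i<n. E b i)" for b
  have G: "clopenin X (G b)" if "b \<in> J" for b
    unfolding G_def using E that by (auto intro!: clopenin_Union)
  have less: "|h ` J| <o \<kappa>" for h :: "'b \<Rightarrow> 'a set"
    using card_of_image J by (rule ordLeq_ordLess_trans)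
  define A where "A i = (\<Union>b\<in>J. E b i)" for i
  have UA: "(\<Union>i<n. A i) = \<Union>(G ` J)"
    by (auto simp: A_def G_def)
  have opA: "openin X (A i)" if "i < n" for i
    unfolding A_def using E that by (auto simp: clopenin_def)
  \<comment> \<open>The clopen sets \<open>G b\<close>, one for each earlier stage, witness that the
    type is less than \<kappa>.\<close>
  have "open_type X (\<Union>i<n. A i) <o \<kappa>"
  proof -
    have "open_type X (\<Union>i<n. A i) \<le>o |G ` J|"
      unfolding open_type_def UA using G by (intro least_card_le) auto
    then show ?thesis
      using less ordLeq_ordLess_trans by blast
  qed
  moreover have "openin X (\<Union>i<n. A i)"
    using opA by auto
  ultimately have emb: "Cstar_embedded X (\<Union>i<n. A i)"
    using F unfolding F_space_def by blast
  have disjA: "A i \<inter> A j = {}" if "i < n" "j < n" "i \<noteq> j" for i j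
    using disj that unfolding A_def by blast
  obtain Q where Q: "\<forall>i<n. clopenin X (Q i) \<and> A i \<subseteq> Q i" "(\<Union>i<n. Q i) = topspace X"
      "\<forall>i<n. \<forall>j<n. i \<noteq> j \<longrightarrow> Q i \<inter> Q j = {}"
    using Cstar_embedded_clopen_partition[OF zd comp n opA disjA emb] by blast
  have xX: "x \<in> topspace X"
    using W by (meson clopenin_def openin_subset subsetD)
  let ?\<U> = "insert W ((\<lambda>b. topspace X - G b) ` J)"
  \<comment> \<open>As \<kappa> is infinite, adding the single set \<open>W\<close> keeps the family
    smaller than \<kappa>.\<close>
  have "|{W} \<union> (\<lambda>b. topspace X - G b) ` J| <o \<kappa>"
  proof (intro card_of_Un_ordLess_infinite_Field less)
    show "infinite (Field \<kappa>)" "Card_order \<kappa>"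
      using inf by (auto simp: cinfinite_def)
    then show "|{W}| <o \<kappa>"
      by (metis Field_card_of card_of_Field_ordIso card_of_Well_order card_of_card_order_on finite.emptyI finite.insertI finite_ordLess_infinite ordLess_ordIso_trans)
  qed
  moreover have "\<forall>U\<in>?\<U>. openin X U"
    using W G by (auto simp: clopenin_def)
  \<comment> \<open>All earlier contributions miss x, so x witnesses that the intersection is
    non-empty.\<close>
  moreover have "x \<in> topspace X \<inter> \<Inter>?\<U>"
    using W xX E by (auto simp: G_def)
  ultimately have "X interior_of (topspace X \<inter> \<Inter>?\<U>) \<noteq> {}"
    by (intro int) (simp_all only: insert_is_Un[symmetric], blast)
  then obtain N where N: "openin X N" "N \<noteq> {}" "N \<subseteq> topspace X \<inter> \<Inter>?\<U>"
    using openin_interior_of interior_of_subset by metis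
  \<comment> \<open>The new sets must miss x, which may lie in \<open>N\<close>; since x is not
    isolated, removing it leaves a non-empty open set.\<close>
  have "N - {x} \<noteq> {}"
    using iso[OF xX] N(1,2) by (metis Diff_eq_empty_iff subset_singletonD)
  moreover have "openin X (N - {x})"
    using N(1) haus xX by (simp add: Hausdorff_imp_t1_space closedin_t1_singleton openin_diff)
  ultimately obtain D where D: "\<forall>i<n. clopenin X (D i) \<and> D i \<noteq> {} \<and> D i \<subseteq> N - {x}"
      "\<forall>i<n. \<forall>j<n. i \<noteq> j \<longrightarrow> D i \<inter> D j = {}"
    using open_contains_disjoint_clopens[OF zd haus iso, of "N - {x}" n] by metis
  have NA: "N \<inter> (\<Union>i<n. A i) = {}" and NW: "N \<subseteq> W"
    using N(3) unfolding UA by blast+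
  have DW: "D i \<subseteq> W" "x \<notin> D i" if "i < n" for i
    using D(1) that NW by auto
  have DA: "D i \<inter> A j = {}" if "i < n" "j < n" for i j
  proof -
    have "D i \<subseteq> N" "A j \<subseteq> (\<Union>i<n. A i)"
      using D(1) that by auto
    then show ?thesis
      using NA by blast
  qed
  \<comment> \<open>Outside \<open>W\<close> the pieces follow the partition \<open>Q\<close>;
    inside \<open>W\<close> only the sets \<open>D i\<close> are added. \<open>D i\<close> may well
    meet \<open>Q j\<close> for j \<noteq> i: this does no harm, because \<open>D i\<close> lies in
    \<open>W\<close> and misses every \<open>A j\<close>.\<close>
  define F where "F i = (Q i - W) \<union> D i" for i
  show ?thesis
  proof (intro exI[of _ F] conjI allI impI ballI)
    fix i assume i: "i < n"
    show "clopenin X (F i)"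
      unfolding F_def using Q(1) D(1) W i by (auto intro!: clopenin_Un clopenin_Diff)
    show "x \<notin> F i"
      using W DW i by (auto simp: F_def)
    show "F i \<inter> W \<noteq> {}"
      using D(1) DW(1) i unfolding F_def by blast
  next
    show "topspace X - W \<subseteq> (\<Union>i<n. F i)"
      using Q(2) by (auto simp: F_def)
  next
    fix i j assume ij: "i < n" "j < n" "i \<noteq> j"
    then have "Q i \<inter> Q j = {}" "D i \<inter> D j = {}" "D i \<subseteq> W" "D j \<subseteq> W"
      using Q(3) D(2) DW(1) by auto
    then show "F i \<inter> F j = {}"
      unfolding F_def by blast
  next
    fix b i j assume ij: "b \<in> J" "i < n" "j < n" "i \<noteq> j"
    then have "E b j \<subseteq> A j" "A j \<subseteq> Q j" "Q i \<inter> Q j = {}" "D i \<inter> A j = {}"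
      using Q DA by (auto simp: A_def)
    then show "F i \<inter> E b j = {}"
      unfolding F_def by blast
  qed
qed

section \<open>Recursion along a neighbourhood base of x\<close>

text \<open>A base of least cardinality can be enumerated by \<open>Field \<kappa>\<close>, possibly
  with repetitions, and each member that contains x shrinks to a clopen neighbourhood of x.\<close>

lemma clopen_nbhd_base_indexed:
  fixes \<kappa> :: "'k rel" and X :: "'a topology"
  assumes \<kappa>: "Card_order \<kappa>" and w: "weight X =o \<kappa>" and zd: "zero_dimensional_space X"
    and x: "x \<in> topspace X"
  obtains W where "\<And>a. clopenin X (W a) \<and> x \<in> W a"
    and "\<And>U. openin X U \<Longrightarrow> x \<in> U \<Longrightarrow> \<exists>a\<in>Field \<kappa>. W a \<subseteq> U"
proof -
  have "{\<B>. base_of X \<B>} \<noteq> {}"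
    using zd by (auto simp: zero_dimensional_space_def)
  from least_card_attained[OF this] obtain \<B> where \<B>: "base_of X \<B>" "|\<B>| =o \<kappa>"
    using w unfolding weight_def by fastforce
  obtain V0 where "V0 \<in> \<B>"
    using \<B>(1) x unfolding base_of_def by blast
  have "|\<B>| \<le>o |Field \<kappa>|"
    using \<B>(2) \<kappa> by (meson card_of_Field_ordIso ordIso_iff_ordLeq ordIso_symmetric ordIso_transitive)
  then obtain h where h: "h ` Field \<kappa> = \<B>"
    using card_of_ordLeq2[of \<B> "Field \<kappa>"] \<open>V0 \<in> \<B>\<close> by blast
  \<comment> \<open>For indices whose base member does not contain x, any clopen neighbourhood is
    allowed, and the whole space is one.\<close>
  have "\<exists>V. clopenin X V \<and> x \<in> V \<and> (a \<in> Field \<kappa> \<and> x \<in> h a \<longrightarrow> V \<subseteq> h a)" for a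
  proof (cases "a \<in> Field \<kappa> \<and> x \<in> h a")
    case True
    then have "openin X (h a)"
      using h \<B>(1) unfolding base_of_def by blast
    then show ?thesis
      using zero_dimensional_space_nbhd[OF zd _ conjunct2[OF True]] by metis
  next
    case False
    then show ?thesis
      using clopenin_topspace x by blast
  qed
  then obtain W where W: "\<And>a. clopenin X (W a) \<and> x \<in> W a"
      "\<And>a. a \<in> Field \<kappa> \<Longrightarrow> x \<in> h a \<Longrightarrow> W a \<subseteq> h a"
    by metis
  have "\<exists>a\<in>Field \<kappa>. W a \<subseteq> U" if U: "openin X U" "x \<in> U" for U
  proof -
    obtain V where "V \<in> \<B>" "x \<in> V" "V \<subseteq> U"
      using \<B>(1) U unfolding base_of_def by blast
    then show ?thesis
      using h W(2) by blast
  qed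
  with W(1) show ?thesis
    using that by blast
qed

lemma Parovicenko_space_split_at_point:
  fixes \<kappa> :: "'k rel" and X :: "'a topology"
  assumes inf: "Cinfinite \<kappa>" and X: "Parovicenko_space \<kappa> X" "weight X =o \<kappa>"
    and x: "x \<in> topspace X" and n: "0 < n"
  shows "\<exists>A::nat \<Rightarrow> 'a set. (\<forall>i<n. openin X (A i) \<and> x \<in> X closure_of A i) \<and>
           (\<forall>i<n. \<forall>j<n. i \<noteq> j \<longrightarrow> A i \<inter> A j = {}) \<and> (\<Union>i<n. A i) = topspace X - {x}"
proof -
  have \<kappa>: "Card_order \<kappa>" and wo: "Well_order \<kappa>"
    using inf card_order_on_well_order_on by auto
  have zd: "zero_dimensional_space X" and haus: "Hausdorff_space X"
    using X unfolding Parovicenko_space_def by auto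
  obtain W where W: "\<And>a. clopenin X (W a) \<and> x \<in> W a"
      "\<And>U. openin X U \<Longrightarrow> x \<in> U \<Longrightarrow> \<exists>a\<in>Field \<kappa>. W a \<subseteq> U"
    using clopen_nbhd_base_indexed[OF \<kappa> X(2) zd x] by blast
  \<comment> \<open>\<open>P f a F\<close> says that \<open>F\<close> is an admissible stage a when
    the earlier stages are given by \<open>f\<close>. It consults \<open>f\<close> only below a, as
    the recursion requires, and it is vacuous for a outside \<open>Field \<kappa>\<close>.\<close>
  define P where "P f a F \<longleftrightarrow> (a \<in> Field \<kappa> \<longrightarrow>
      (\<forall>i<n. clopenin X (F i) \<and> x \<notin> F i \<and> F i \<inter> W a \<noteq> {}) \<and>
      topspace X - W a \<subseteq> (\<Union>i<n. F i) \<and>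
      (\<forall>i<n. \<forall>j<n. i \<noteq> j \<longrightarrow> F i \<inter> F j = {}) \<and>
      (\<forall>b\<in>underS \<kappa> a. \<forall>i<n. \<forall>j<n. i \<noteq> j \<longrightarrow> F i \<inter> f b j = {}))"
    for f :: "'k \<Rightarrow> nat \<Rightarrow> 'a set" and a F
  \<comment> \<open>Each stage is only required to avoid earlier ones; totality of \<kappa> turns
    this into disjointness for any two stages. As \<open>f\<close> has to be admissible at b and c
    only, this applies both during the recursion and to its result.\<close>
  have cross: "f b i \<inter> f c j = {}"
    if that': "P f b (f b)" "P f c (f c)" "b \<in> Field \<kappa>" "c \<in> Field \<kappa>" "i < n" "j < n" "i \<noteq> j" for f b c i j
  proof -
    consider "b = c" | "b \<in> underS \<kappa> c" | "c \<in> underS \<kappa> b"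
      using wo that'(3,4) unfolding well_order_on_def linear_order_on_def total_on_def underS_def by blast
    then show ?thesis
    proof cases
      case 2
      then have "f c j \<inter> f b i = {}"
        using that' unfolding P_def by metis
      then show ?thesis by blast
    qed (use that' in \<open>(simp add: P_def)+\<close>)
  qed
  have "\<exists>E. \<forall>a. P E a (E a)"
  proof (rule dependent_wf_choice)
    show "wf (\<kappa> - Id)"
      using wo by (simp add: well_order_on_def)
    show "P f a F = P g a F" if "\<And>z. (z, a) \<in> \<kappa> - Id \<Longrightarrow> f z = g z" for f g a F
      using that by (simp add: P_def underS_def)
    fix a and f :: "'k \<Rightarrow> nat \<Rightarrow> 'a set"
    assume IH: "\<And>b. (b, a) \<in> \<kappa> - Id \<Longrightarrow> P f b (f b)"
    show "\<exists>F. P f a F"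
    proof (cases "a \<in> Field \<kappa>")
      case True
      have u: "P f b (f b)" "b \<in> Field \<kappa>" if "b \<in> underS \<kappa> a" for b
        using that IH by (auto simp: underS_def Field_def)
      have "clopenin X (f b i) \<and> x \<notin> f b i" if "b \<in> underS \<kappa> a" "i < n" for b i
        using u[OF that(1)] that(2) unfolding P_def by blast
      \<comment> \<open>A proper initial segment of the cardinal \<kappa> has fewer than \<kappa>
        elements, so there are few enough earlier stages.\<close>
      then show ?thesis
        unfolding P_def
        using Parovicenko_space_extend_partition[OF inf X(1) n card_of_underS[OF \<kappa> True], of f x "W a"]
          cross u W(1) by simp
    qed (simp add: P_def)
  qed
  then obtain E where PE: "\<And>a. P E a (E a)"
    by blast
  have E: "clopenin X (E a i)" "x \<notin> E a i" "E a i \<inter> W a \<noteq> {}" if "a \<in> Field \<kappa>" "i < n" for a i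
    using PE[of a] that by (simp_all add: P_def)
  have cover: "topspace X - W a \<subseteq> (\<Union>i<n. E a i)" if "a \<in> Field \<kappa>" for a
    using PE[of a] that by (simp add: P_def)
  define A where "A i = (\<Union>a\<in>Field \<kappa>. E a i)" for i
  show ?thesis
  proof (intro exI[of _ A] conjI allI impI)
    fix i assume i: "i < n"
    show "openin X (A i)"
      using E(1) i unfolding A_def clopenin_def by blast
    show "x \<in> X closure_of A i"
      unfolding in_closure_of
    proof (intro conjI allI impI x)
      fix T assume "x \<in> T \<and> openin X T"
      then obtain a where "a \<in> Field \<kappa>" "W a \<subseteq> T"
        using W(2) by blast
      then show "\<exists>y. y \<in> A i \<and> y \<in> T"
        using E(3)[OF _ i, of a] unfolding A_def by blast
    qed
  next
    fix i j assume "i < n" "j < n" "i \<noteq> j"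
    then show "A i \<inter> A j = {}"
      using cross[OF PE PE] unfolding A_def by blast
  next
    show "(\<Union>i<n. A i) = topspace X - {x}"
    proof
      show "(\<Union>i<n. A i) \<subseteq> topspace X - {x}"
        using E(1,2) openin_subset unfolding A_def clopenin_def by blast
      show "topspace X - {x} \<subseteq> (\<Union>i<n. A i)"
      proof
        fix y assume y: "y \<in> topspace X - {x}"
        \<comment> \<open>Some \<open>W a\<close> avoids y, hence y has been put into a piece by
          stage a at the latest.\<close>
        have "openin X (topspace X - {y})"
          using haus y by (simp add: Hausdorff_imp_t1_space closedin_t1_singleton openin_diff)
        then obtain a where "a \<in> Field \<kappa>" "W a \<subseteq> topspace X - {y}"
          using W(2)[of "topspace X - {y}"] x y by blast
        then show "y \<in> (\<Union>i<n. A i)"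
          using cover[of a] y unfolding A_def by blast
      qed
    qed
  qed
qed

section \<open>Replacing x by n points\<close>

lemma finite_compactification_split_point:
  fixes A :: "nat \<Rightarrow> 'a set"
  assumes comp: "compact_space X" and haus: "Hausdorff_space X" and x: "x \<in> topspace X"
    and A: "\<And>i. i < n \<Longrightarrow> openin X (A i)" "\<And>i. i < n \<Longrightarrow> x \<in> X closure_of A i"
    and disj: "\<And>i j. i < n \<Longrightarrow> j < n \<Longrightarrow> i \<noteq> j \<Longrightarrow> A i \<inter> A j = {}"
    and cover: "(\<Union>i<n. A i) = topspace X - {x}"
  shows "\<exists>(Z :: ('a + nat) topology) e.
           finite_compactification (subtopology X (topspace X - {x})) Z e \<and>
           card (topspace Z - e ` (topspace X - {x})) = n"
proof -
  \<comment> \<open>The closed subset S of the product of X with n discrete points consists of the points (y, c y) for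
      y in A (c y), together with the n copies (x, i) of x; it is transported to the type of Z along g.\<close>
  define c where "c y = (THE i. i < n \<and> y \<in> A i)" for y
  have c: "c y = i" if "i < n" "y \<in> A i" for y i
    unfolding c_def by (rule the_index_disjoint_family[of n A, OF disj that])
  have c2: "c y < n" "y \<in> A (c y)" if "y \<in> topspace X" "y \<noteq> x" for y
  proof -
    have "y \<in> (\<Union>i<n. A i)"
      unfolding cover using that by simp
    then obtain i where "i < n" "y \<in> A i"
      by blast
    then show "c y < n" "y \<in> A (c y)"
      using c[of i y] by simp_all
  qed
  have "A i \<subseteq> topspace X - {x}" if "i < n" for i
    unfolding cover[symmetric] using that by blast
  then have xA: "x \<notin> A i" and AX: "A i \<subseteq> topspace X" if "i < n" for i
    using that by blast+
  define P where "P = prod_topology X (discrete_topology {..<n})"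
  define T where "T = Inl ` (topspace X - {x}) \<union> Inr ` {..<n}"
  define g where "g z = (case z of Inl y \<Rightarrow> (y, c y) | Inr i \<Rightarrow> (x, i))" for z
  define Z where "Z = pullback_topology T g P"
  define S where "S = topspace P - (\<Union>i<n. \<Union>j\<in>{..<n} - {i}. A j \<times> {i})"
  have tP: "topspace P = topspace X \<times> {..<n}"
    by (simp add: P_def)
  have gT: "g ` T = S"
  proof
    show "g ` T \<subseteq> S"
    proof
      fix z assume "z \<in> g ` T"
      then obtain t where "t \<in> T" "z = g t"
        by blast
      then consider y where "y \<in> topspace X" "y \<noteq> x" "z = (y, c y)" | i where "i < n" "z = (x, i)"
        unfolding T_def g_def by fastforce
      then show "z \<in> S"
      proof cases
        case 1
        have "y \<notin> A j" if "j < n" "j \<noteq> c y" for j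
          using c[of j y] that by blast
        then show ?thesis
          using 1 c2[of y] by (auto simp: S_def tP)
      next
        case 2
        then show ?thesis
          using x xA by (auto simp: S_def tP)
      qed
    qed
    show "S \<subseteq> g ` T"
    proof
      fix z assume z: "z \<in> S"
      obtain y i where yi: "z = (y, i)" by force
      then have y: "y \<in> topspace X" "i < n" "\<And>j. j < n \<Longrightarrow> j \<noteq> i \<Longrightarrow> y \<notin> A j"
        using z by (auto simp: S_def tP)
      show "z \<in> g ` T"
      proof (cases "y = x")
        case True
        then show ?thesis
          using y yi by (intro image_eqI[of _ _ "Inr i"]) (auto simp: g_def T_def)
      next
        case False
        then have "c y = i"
          using y c2[of y] by blast
        then show ?thesis
          using False y yi by (intro image_eqI[of _ _ "Inl y"]) (auto simp: g_def T_def)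
      qed
    qed
  qed
  have opZ: "openin Z V \<longleftrightarrow> (\<exists>U. openin P U \<and> V = g -` U \<inter> T)" for V
    by (simp add: Z_def openin_pullback_topology)
  have gTP: "g ` T \<subseteq> topspace P"
    unfolding gT S_def by auto
  then have tZ: "topspace Z = T"
    unfolding Z_def topspace_pullback_topology by auto
  \<comment> \<open>Slices translate open sets of the product back to X; this gives both the
    continuity of \<open>Inl\<close> and the density of its image.\<close>
  have slice: "openin X {y \<in> topspace X. (y, i) \<in> U}" if "openin P U" "i < n" for U i
    by (rule openin_continuous_map_preimage[OF _ that(1)])
       (use that(2) in \<open>auto simp: P_def intro!: continuous_map_pairedI\<close>)
  \<comment> \<open>Compactness and the Hausdorff property pass from the closed subspace
    \<open>S\<close> of the product to \<open>Z\<close> along this homeomorphism.\<close>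
  have "homeomorphic_map Z (subtopology P S) g"
  proof (rule bijective_open_imp_homeomorphic_map)
    show "continuous_map Z (subtopology P S) g"
    proof (rule continuous_map_into_subtopology)
      show "continuous_map Z P g"
        unfolding continuous_map_def
      proof (intro conjI allI impI)
        show "g \<in> topspace Z \<rightarrow> topspace P"
          using gTP tZ by auto
        fix U assume "openin P U"
        moreover have "{z \<in> topspace Z. g z \<in> U} = g -` U \<inter> T"
          using tZ by auto
        ultimately show "openin Z {z \<in> topspace Z. g z \<in> U}"
          using opZ by blast
      qed
      show "g \<in> topspace Z \<rightarrow> S"
        using gT tZ by auto
    qed
    show "open_map Z (subtopology P S) g"
      unfolding open_map_def
    proof (intro allI impI)
      fix V assume "openin Z V"
      then obtain U where U: "openin P U" "V = g -` U \<inter> T"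
        using opZ by blast
      then have "g ` V = U \<inter> S"
        using gT by auto
      then show "openin (subtopology P S) (g ` V)"
        using U by (auto simp: openin_subtopology)
    qed
    show "g ` topspace Z = topspace (subtopology P S)"
      using gT gTP tZ by auto
    show "inj_on g (topspace Z)"
      unfolding tZ by (auto simp: inj_on_def T_def g_def)
  qed
  then have hom: "Z homeomorphic_space subtopology P S"
    by (auto simp: homeomorphic_space)
  have compP: "compact_space P"
    unfolding P_def using comp by (simp add: compact_space_prod_topology compact_space_discrete_topology)
  have "openin P (A j \<times> {i})" if "i < n" "j < n" for i j
    unfolding P_def using A(1) that by (intro openin_prod_Times_iff[THEN iffD2]) auto
  then have "closedin P S"
    unfolding S_def by (intro closedin_diff closedin_topspace openin_Union) auto
  then have Z_compact: "compact_space Z"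
    using hom closedin_compact_space[OF compP] by (simp add: compactin_subspace homeomorphic_compact_space)
  have "Hausdorff_space P"
    unfolding P_def using haus by (simp add: Hausdorff_space_prod_topology)
  then have Z_Hausdorff: "Hausdorff_space Z"
    using hom by (simp add: homeomorphic_Hausdorff_space Hausdorff_space_subtopology)
  let ?Y = "topspace X - {x}"
  have "closedin X {x}"
    using haus x by (simp add: Hausdorff_imp_t1_space closedin_t1_singleton)
  then have opY: "openin X ?Y"
    by (simp add: openin_diff)
  have tY: "topspace (subtopology X ?Y) = ?Y"
    by auto
  have emb: "embedding_map (subtopology X ?Y) Z Inl"
  proof (rule injective_open_imp_embedding_map)
    show "continuous_map (subtopology X ?Y) Z Inl"
      unfolding continuous_map_def
    proof (intro conjI allI impI)
      show "Inl \<in> topspace (subtopology X ?Y) \<rightarrow> topspace Z"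
        by (auto simp: tZ T_def)
      fix V assume "openin Z V"
      then obtain U where U: "openin P U" "V = g -` U \<inter> T"
        using opZ by blast
      \<comment> \<open>The label \<open>c\<close> is constantly i on the open set
        \<open>A i\<close>, so there the preimage of \<open>V\<close> is a slice.\<close>
      have "{y \<in> topspace (subtopology X ?Y). Inl y \<in> V} = (\<Union>i<n. A i \<inter> {y \<in> topspace X. (y, i) \<in> U})"
        (is "?L = ?R")
      proof
        show "?L \<subseteq> ?R"
        proof
          fix y assume "y \<in> ?L"
          then have "y \<in> topspace X" "y \<noteq> x" "(y, c y) \<in> U"
            unfolding tY U(2) by (auto simp: g_def)
          then show "y \<in> ?R"
            using c2[of y] by blast
        qed
        show "?R \<subseteq> ?L"
        proof
          fix y assume "y \<in> ?R"
          then obtain i where "i < n" "y \<in> A i" "y \<in> topspace X" "(y, i) \<in> U"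
            by blast
          then show "y \<in> ?L"
            unfolding tY U(2) using c[of i y] xA[of i] by (auto simp: g_def T_def)
        qed
      qed
      moreover have "openin X ?R"
        using A(1) slice[OF U(1)] by auto
      ultimately have "openin X ?L"
        by (rule ssubst)
      moreover have "?L \<subseteq> ?Y"
        unfolding tY by (rule Collect_restrict)
      ultimately show "openin (subtopology X ?Y) ?L"
        using openin_open_subtopology[OF opY] by blast
    qed
    show "open_map (subtopology X ?Y) Z Inl"
      unfolding open_map_def
    proof (intro allI impI)
      fix V assume "openin (subtopology X ?Y) V"
      then have V: "openin X V" "V \<subseteq> ?Y"
        using openin_open_subtopology[OF opY] by auto
      have "openin P (V \<times> {..<n})"
        unfolding P_def using V by (intro openin_prod_Times_iff[THEN iffD2]) auto
      \<comment> \<open>No point \<open>Inr i\<close> enters the preimage, because \<open>g\<close>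
        sends it over x and \<open>V\<close> misses x.\<close>
      moreover have "Inl ` V = g -` (V \<times> {..<n}) \<inter> T"
      proof -
        have "y \<in> topspace X" "y \<noteq> x" "c y < n" if "y \<in> V" for y
          using V(2) c2(1)[of y] that by auto
        then show ?thesis
          using V(2) by (auto simp: g_def T_def)
      qed
      ultimately show "openin Z (Inl ` V)"
        using opZ by blast
    qed
  qed (auto simp: inj_on_def)
  have diff: "topspace Z - Inl ` ?Y = Inr ` {..<n}"
    unfolding tZ T_def by auto
  have dense: "Z closure_of (Inl ` ?Y) = topspace Z"
  proof
    show "topspace Z \<subseteq> Z closure_of (Inl ` ?Y)"
    proof
      fix z assume z: "z \<in> topspace Z"
      show "z \<in> Z closure_of (Inl ` ?Y)"
      proof (cases "z \<in> Inl ` ?Y")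
        case True
        then show ?thesis
          using z by (metis closure_of_subset_Int IntI subsetD)
      next
        case False
        then obtain i where i: "i < n" "z = Inr i"
          using z diff by blast
        show ?thesis
          unfolding in_closure_of
        proof (intro conjI allI impI z)
          fix V assume "z \<in> V \<and> openin Z V"
          then obtain U where U: "openin P U" "V = g -` U \<inter> T" "z \<in> V"
            using opZ by blast
          \<comment> \<open>The slice at i of a neighbourhood of \<open>Inr i\<close> is a
            neighbourhood of x, so it meets \<open>A i\<close>, whose points carry the label
            i.\<close>
          then have "x \<in> {y \<in> topspace X. (y, i) \<in> U}"
            using i x by (auto simp: g_def)
          then obtain y where y: "y \<in> A i" "(y, i) \<in> U"
            using A(2)[OF i(1), unfolded in_closure_of] slice[OF U(1) i(1)] by (metis (lifting) mem_Collect_eq)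
          then have "Inl y \<in> V" "Inl y \<in> Inl ` ?Y"
            using U(2) c[OF i(1) y(1)] y xA[OF i(1)] AX[OF i(1)] by (auto simp: g_def T_def)
          then show "\<exists>y. y \<in> Inl ` ?Y \<and> y \<in> V"
            by (intro exI[of _ "Inl y"] conjI)
        qed
      qed
    qed
  qed (rule closure_of_subset_topspace)
  have "finite (topspace Z - Inl ` ?Y)"
    unfolding diff by simp
  then have "finite_compactification (subtopology X ?Y) Z Inl"
    unfolding finite_compactification_def tY
    by (intro conjI Z_compact Z_Hausdorff emb dense)
  moreover have "card (topspace Z - Inl ` ?Y) = n"
    unfolding diff by (simp add: card_image)
  ultimately show ?thesis
    by blast
qed

theorem mainTheorem4:
  fixes \<kappa> :: "'k rel" and X :: "'a topology"
  assumes "Cinfinite \<kappa>" and "\<kappa> =o card_less_power \<kappa>"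
    and "is_S \<kappa> X"
  shows "\<forall>x\<in>topspace X. \<forall>n::nat. \<exists>(Z :: ('a + nat) topology) e.
           finite_compactification (subtopology X (topspace X - {x})) Z e \<and>
           n \<le> card (topspace Z - e ` (topspace X - {x}))"
proof (intro ballI allI)
  fix x and n :: nat
  assume x: "x \<in> topspace X"
  have X: "Parovicenko_space \<kappa> X" "weight X =o \<kappa>" "compact_space X" "Hausdorff_space X"
    using assms(3) unfolding is_S_def Parovicenko_space_def by auto
  \<comment> \<open>Splitting requires at least one piece; taking \<open>Suc n\<close> of them
    covers n = 0 as well.\<close>
  obtain A :: "nat \<Rightarrow> 'a set" where A: "\<forall>i<Suc n. openin X (A i) \<and> x \<in> X closure_of A i"
      "\<forall>i<Suc n. \<forall>j<Suc n. i \<noteq> j \<longrightarrow> A i \<inter> A j = {}" "(\<Union>i<Suc n. A i) = topspace X - {x}"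
    using Parovicenko_space_split_at_point[OF assms(1) X(1,2) x zero_less_Suc[of n]] by blast
  then obtain Z :: "('a + nat) topology" and e
    where "finite_compactification (subtopology X (topspace X - {x})) Z e"
      "card (topspace Z - e ` (topspace X - {x})) = Suc n"
    using finite_compactification_split_point[OF X(3,4) x, of "Suc n" A] by blast
  then show "\<exists>(Z :: ('a + nat) topology) e.
           finite_compactification (subtopology X (topspace X - {x})) Z e \<and>
           n \<le> card (topspace Z - e ` (topspace X - {x}))"
    by (metis le_SucI order_refl)
qed

end
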